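(* Let $s, r, k, n_1, \ldots, n_r$ be positive integers with $r\geq 4$, $2\leq s\leq r$, $n_1\leq n_2\leq\cdots\leq n_r$ and $k\leq n_1$. If $n_4\geq r^r(k-1)k^{2r-2}$, then $$ex\left(K_{n_1,\ldots,n_r},\, K_s,\, kK_r\right)=\sum_{\substack{A\subset\{1,\ldots,r\}\\ |A|=s,\ \{1,2\}\not\subset A}}\ \prod_{i\in A}n_i\;+\;\sum_{\substack{A\subset\{3,\ldots,r\}\\ |A|=s-2}}(k-1)\,n_2\prod_{i\in A}n_i.$$
   Context: For graphs $G,T,F$, $ex(G,T,F)$ denotes the maximum number of copies of $T$ in an $F$-free subgraph of $G$, where a graph is $F$-free if it contains no copy of $F$ as a (not necessarily induced) subgraph. $K_t$ is the complete graph on $t$ vertices (so copies of $K_s$ in a graph are its $s$-cliques, i.e. $s$-element vertex sets that are pairwise adjacent), and $kK_r$ is the graph consisting of $k$ vertex-disjoint copies of $K_r$. $K_{n_1,\ldots,n_r}$ denotes the complete $r$-partite graph with vertex classes of sizes $n_1,\ldots,n_r$. An empty product equals $1$ (so for $s=2$ the second sum has the single term $(k-1)n_2$, coming from $A=\emptyset$). *)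

theory Defs
  imports Main
begin

datatype 'a graph = Graph (verts: "'a set") (edges: "'a set set")

definition simple_graph :: "'a graph \<Rightarrow> bool" where
  "simple_graph G \<longleftrightarrow> finite (verts G) \<and> (\<forall>e\<in>edges G. e \<subseteq> verts G \<and> card e = 2)"

text \<open>Subgraphs are neither required to be induced nor to be spanning.\<close>

definition subgraph :: "'a graph \<Rightarrow> 'a graph \<Rightarrow> bool" where
  "subgraph H G \<longleftrightarrow> simple_graph H \<and> verts H \<subseteq> verts G \<and> edges H \<subseteq> edges G"

definition isomorphic :: "'a graph \<Rightarrow> 'b graph \<Rightarrow> bool" where
  "isomorphic G H \<longleftrightarrow> (\<exists>f. bij_betw f (verts G) (verts H) \<and> (`) f ` edges G = edges H)"

text \<open>A copy of \<open>T\<close> in \<open>G\<close> is a subgraph of \<open>G\<close>, not an embedding of \<open>T\<close>, so automorphisms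
  of \<open>T\<close> do not lead to multiple counting.\<close>

definition copies :: "'a graph \<Rightarrow> 'b graph \<Rightarrow> 'b graph set" where
  "copies T G = {T'. subgraph T' G \<and> isomorphic T T'}"

definition free_of :: "'a graph \<Rightarrow> 'b graph \<Rightarrow> bool" where
  "free_of F G \<longleftrightarrow> copies F G = {}"

text \<open>The set below is finite for simple \<open>G\<close>, and contains 0 if \<open>T\<close> and \<open>F\<close> have at least
  one vertex each (take the subgraph without vertices).\<close>

definition ex :: "'a graph \<Rightarrow> 'b graph \<Rightarrow> 'c graph \<Rightarrow> nat" where
  "ex G T F = Max {card (copies T H) | H. subgraph H G \<and> free_of F H}"

definition complete_graph :: "nat \<Rightarrow> nat graph" where
  "complete_graph t = Graph {..<t} {e. e \<subseteq> {..<t} \<and> card e = 2}"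

definition disjoint_copies :: "nat \<Rightarrow> 'a graph \<Rightarrow> (nat \<times> 'a) graph" where
  "disjoint_copies k G = Graph ({..<k} \<times> verts G) {Pair i ` e | i e. i < k \<and> e \<in> edges G}"

text \<open>The classes are numbered \<open>1, \<dots>, r\<close>; class \<open>i\<close> is \<open>{i} \<times> {..<n i}\<close>. Values of \<open>n\<close>
  outside \<open>{1..r}\<close> are irrelevant.\<close>

definition complete_multipartite :: "nat \<Rightarrow> (nat \<Rightarrow> nat) \<Rightarrow> (nat \<times> nat) graph" where
  "complete_multipartite r n =
    (let V = (SIGMA i:{1..r}. {..<n i})
     in Graph V {{u, v} | u v. u \<in> V \<and> v \<in> V \<and> fst u \<noteq> fst v})"

lemma simple_graph_complete_graph: "simple_graph (complete_graph t)"
  by (auto simp: simple_graph_def complete_graph_def)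

lemma simple_graph_disjoint_copies:
  assumes "simple_graph G"
  shows "simple_graph (disjoint_copies k G)"
  using assms by (fastforce simp: simple_graph_def disjoint_copies_def card_image inj_on_def)

lemma simple_graph_complete_multipartite: "simple_graph (complete_multipartite r n)"
  by (auto simp: simple_graph_def complete_multipartite_def Let_def card_2_iff)

lemma finite_subgraphs:
  assumes "simple_graph G"
  shows "finite {H. subgraph H G}"
proof (rule finite_subset)
  show "{H. subgraph H G} \<subseteq> (\<lambda>(V, E). Graph V E) ` (Pow (verts G) \<times> Pow (edges G))"
  proof
    fix H assume "H \<in> {H. subgraph H G}"
    then have "(verts H, edges H) \<in> Pow (verts G) \<times> Pow (edges G)"
      by (auto simp: subgraph_def)
    then show "H \<in> (\<lambda>(V, E). Graph V E) ` (Pow (verts G) \<times> Pow (edges G))"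
      by (intro image_eqI[where x = "(verts H, edges H)"]) auto
  qed
  have "edges G \<subseteq> Pow (verts G)" "finite (verts G)"
    using assms by (auto simp: simple_graph_def)
  then show "finite ((\<lambda>(V, E). Graph V E) ` (Pow (verts G) \<times> Pow (edges G)))"
    by (meson finite_Pow_iff finite_SigmaI finite_imageI finite_subset)
qed

lemma copies_complete_graph:
  assumes "simple_graph G"
  shows "copies (complete_graph s) G =
    (\<lambda>S. Graph S {e. e \<subseteq> S \<and> card e = 2}) `
      {S. S \<subseteq> verts G \<and> card S = s \<and> (\<forall>u\<in>S. \<forall>v\<in>S. u \<noteq> v \<longrightarrow> {u, v} \<in> edges G)}"
    (is "?L = ?R")
proof
  have img: "(`) f ` {e. e \<subseteq> A \<and> card e = 2} = {e. e \<subseteq> B \<and> card e = 2}"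
    if f: "bij_betw f A B" for f :: "nat \<Rightarrow> 'a" and A B
  proof (intro equalityI subsetI)
    fix e assume "e \<in> (`) f ` {e. e \<subseteq> A \<and> card e = 2}"
    then show "e \<in> {e. e \<subseteq> B \<and> card e = 2}"
      using f by (auto simp: bij_betw_def card_image inj_on_subset)
  next
    fix e assume e: "e \<in> {e. e \<subseteq> B \<and> card e = 2}"
    then obtain d where d: "d \<subseteq> A" "e = f ` d"
      using f by (auto simp: bij_betw_def subset_image_iff)
    then have "card d = 2"
      using e f by (metis (mono_tags) bij_betw_def card_image inj_on_subset mem_Collect_eq)
    with d show "e \<in> (`) f ` {e. e \<subseteq> A \<and> card e = 2}" by blast
  qed
  show "?L \<subseteq> ?R"
  proof
    fix T assume "T \<in> ?L"
    then obtain f where T: "subgraph T G" and f: "bij_betw f {..<s} (verts T)"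
      and E: "edges T = (`) f ` {e. e \<subseteq> {..<s} \<and> card e = 2}"
      by (auto simp: copies_def isomorphic_def complete_graph_def)
    have ET: "edges T = {e. e \<subseteq> verts T \<and> card e = 2}" using img[OF f] E by simp
    have "card (verts T) = s" using bij_betw_same_card[OF f] by simp
    moreover have "{u, v} \<in> edges G" if "u \<in> verts T" "v \<in> verts T" "u \<noteq> v" for u v
      using that T ET by (auto simp: subgraph_def)
    moreover have "T = Graph (verts T) {e. e \<subseteq> verts T \<and> card e = 2}"
      using ET by (metis graph.collapse)
    ultimately show "T \<in> ?R" using T by (auto simp: subgraph_def)
  qed
  show "?R \<subseteq> ?L"
  proof
    fix T assume "T \<in> ?R"
    then obtain S where S: "S \<subseteq> verts G" "card S = s"
      "\<forall>u\<in>S. \<forall>v\<in>S. u \<noteq> v \<longrightarrow> {u, v} \<in> edges G"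
      and T: "T = Graph S {e. e \<subseteq> S \<and> card e = 2}" by blast
    have fin: "finite S" using S assms finite_subset by (auto simp: simple_graph_def)
    then obtain f where f: "bij_betw f {..<s} S"
      using S(2) by (metis ex_bij_betw_nat_finite lessThan_atLeast0)
    have "subgraph T G"
      using S T fin by (auto simp: subgraph_def simple_graph_def card_2_iff)
    then show "T \<in> ?L"
      using f img[OF f] T by (auto simp: copies_def isomorphic_def complete_graph_def)
  qed
qed

end

theory Submission
  imports Defs "HOL-Library.FuncSet" "HOL-Combinatorics.Transposition"
begin

text \<open>
  Call a tuple \<open>x\<close> with one vertex from each of the \<open>r\<close> classes a transversal, and give an index
  set \<open>A\<close> of size \<open>s\<close> the weight \<open>\<Prod>i\<in>A. n i\<close>. If \<open>x\<close> is a uniformly random transversal,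
  its restriction to \<open>A\<close> is uniform too, so the number of \<open>s\<close>-cliques of a subgraph \<open>H\<close> is the
  expected total weight of the sets \<open>A\<close> on which \<open>x\<close> is a clique of \<open>H\<close>. It therefore suffices
  to bound this weight for every \<open>x\<close> and to bound the probability of the bad case.

  \<^item> If \<open>x\<close> is not a clique on all classes, it misses an edge between some classes \<open>i\<close> and \<open>j\<close>,
    and all sets \<open>A\<close> containing both are lost. Because the class sizes increase, the lost weight is
    smallest for the pair \<open>{1, 2}\<close> (\<open>weight_through_pair_least_12\<close>).
  \<^item> If \<open>H\<close> has no \<open>k\<close> disjoint \<open>r\<close>-cliques, then \<open>x\<close> is a clique with probability at most
    \<open>(k - 1) / n 1\<close>: the \<open>n 1\<close> cyclic shifts of \<open>x\<close> are pairwise disjoint, so that at most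
    \<open>k - 1\<close> of them are cliques, and each shift is itself uniformly distributed
    (\<open>card_clique_transversals_le\<close>).

  In expectation the weight of the sets containing \<open>{1, 2}\<close>, which is \<open>n 1 * n 2\<close> times the
  sum of the products over \<open>(s - 2)\<close>-subsets of \<open>{3..r}\<close>, is thus counted at most
  \<open>(k - 1) / n 1\<close> times, and this is the second sum of the theorem.

  The bound is attained when only \<open>k - 1\<close> vertices of class 1 keep their edges to class 2: every
  \<open>r\<close>-clique has to use one of them.
\<close>

section \<open>Copies as embeddings\<close>

lemma free_of_iff_no_embedding:
  assumes "simple_graph F"
  shows "free_of F G \<longleftrightarrow>
    \<not> (\<exists>f. inj_on f (verts F) \<and> f ` verts F \<subseteq> verts G \<and> (\<forall>e\<in>edges F. f ` e \<in> edges G))"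
proof -
  have "copies F G \<noteq> {} \<longleftrightarrow>
    (\<exists>f. inj_on f (verts F) \<and> f ` verts F \<subseteq> verts G \<and> (\<forall>e\<in>edges F. f ` e \<in> edges G))"
    (is "_ \<longleftrightarrow> (\<exists>f. ?emb f)")
  proof
    assume "copies F G \<noteq> {}"
    then obtain T f where "subgraph T G" and f: "bij_betw f (verts F) (verts T)"
      "(`) f ` edges F = edges T"
      by (auto simp: copies_def isomorphic_def)
    then have "?emb f" by (auto simp: subgraph_def bij_betw_def)
    then show "\<exists>f. ?emb f" by blast
  next
    assume "\<exists>f. ?emb f"
    then obtain f where f: "?emb f" by blast
    let ?T = "Graph (f ` verts F) ((`) f ` edges F)"
    have "card (f ` e) = 2" "f ` e \<subseteq> f ` verts F" if "e \<in> edges F" for e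
    proof -
      have e: "e \<subseteq> verts F" "card e = 2"
        using that assms by (auto simp: simple_graph_def)
      then have "inj_on f e" using f by (meson inj_on_subset)
      then show "card (f ` e) = 2" using e by (simp add: card_image)
      show "f ` e \<subseteq> f ` verts F" using e by blast
    qed
    then have "subgraph ?T G"
      using f assms by (auto simp: subgraph_def simple_graph_def)
    moreover have "isomorphic F ?T"
      using f by (auto simp: isomorphic_def bij_betw_def)
    ultimately show "copies F G \<noteq> {}" by (auto simp: copies_def)
  qed
  then show ?thesis unfolding free_of_def by blast
qed

lemma edges_disjoint_complete_graphs:
  "edges (disjoint_copies k (complete_graph r)) =
    {{(l, i), (l, j)} | l i j. l < k \<and> i < r \<and> j < r \<and> i \<noteq> j}"
proof (intro equalityI subsetI)
  fix e assume "e \<in> edges (disjoint_copies k (complete_graph r))"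
  then obtain l d where "l < k" "d \<subseteq> {..<r}" "card d = 2" "e = Pair l ` d"
    by (auto simp: disjoint_copies_def complete_graph_def)
  moreover from \<open>card d = 2\<close> obtain i j where "d = {i, j}" "i \<noteq> j"
    by (auto simp: card_2_iff)
  ultimately show "e \<in> {{(l, i), (l, j)} | l i j. l < k \<and> i < r \<and> j < r \<and> i \<noteq> j}"
    by auto
next
  fix e assume "e \<in> {{(l, i), (l, j)} | l i j. l < k \<and> i < r \<and> j < r \<and> i \<noteq> j}"
  then obtain l i j where "l < k" "i < r" "j < r" "i \<noteq> j" and e: "e = Pair l ` {i, j}"
    by auto
  then have "{i, j} \<in> edges (complete_graph r)"
    by (auto simp: complete_graph_def)
  then show "e \<in> edges (disjoint_copies k (complete_graph r))"
    using e \<open>l < k\<close> by (auto simp: disjoint_copies_def)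
qed

lemma free_of_disjoint_complete_graphs:
  "free_of (disjoint_copies k (complete_graph r)) G \<longleftrightarrow>
    \<not> (\<exists>f. inj_on f ({..<k} \<times> {..<r}) \<and> f ` ({..<k} \<times> {..<r}) \<subseteq> verts G \<and>
      (\<forall>l<k. \<forall>i<r. \<forall>j<r. i \<noteq> j \<longrightarrow> {f (l, i), f (l, j)} \<in> edges G))"
proof -
  let ?F = "disjoint_copies k (complete_graph r)"
  have "simple_graph ?F"
    by (intro simple_graph_disjoint_copies simple_graph_complete_graph)
  moreover have "verts ?F = {..<k} \<times> {..<r}"
    by (simp add: disjoint_copies_def complete_graph_def)
  moreover have "(\<forall>e\<in>edges ?F. f ` e \<in> edges G) \<longleftrightarrow>
    (\<forall>l<k. \<forall>i<r. \<forall>j<r. i \<noteq> j \<longrightarrow> {f (l, i), f (l, j)} \<in> edges G)"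
    (is "?emb \<longleftrightarrow> ?adj") for f
  proof
    assume emb: ?emb
    show ?adj
    proof (intro allI impI)
      fix l i j assume "l < k" "i < r" "j < r" "i \<noteq> j"
      then have "{(l, i), (l, j)} \<in> edges ?F" by (auto simp: edges_disjoint_complete_graphs)
      then have "f ` {(l, i), (l, j)} \<in> edges G" using emb by blast
      then show "{f (l, i), f (l, j)} \<in> edges G" by simp
    qed
  next
    assume ?adj
    then show ?emb by (auto simp: edges_disjoint_complete_graphs)
  qed
  ultimately show ?thesis by (simp add: free_of_iff_no_embedding)
qed

section \<open>Cliques as partial transversals\<close>

definition transversal_clique :: "('i \<times> 'v) set set \<Rightarrow> 'i set \<Rightarrow> ('i \<Rightarrow> 'v) \<Rightarrow> bool" where
  "transversal_clique E A x \<longleftrightarrow> (\<forall>i\<in>A. \<forall>j\<in>A. i \<noteq> j \<longrightarrow> {(i, x i), (j, x j)} \<in> E)"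

abbreviation tuples :: "('i \<Rightarrow> nat) \<Rightarrow> 'i set \<Rightarrow> ('i \<Rightarrow> nat) set" where
  "tuples n A \<equiv> (\<Pi>\<^sub>E i\<in>A. {..<n i})"

lemma transversal_clique_cong:
  assumes "\<And>i. i \<in> A \<Longrightarrow> x i = y i"
  shows "transversal_clique E A x \<longleftrightarrow> transversal_clique E A y"
  using assms by (simp add: transversal_clique_def)

lemma card_tuples: "finite A \<Longrightarrow> card (tuples n A) = (\<Prod>i\<in>A. n i)"
  by (simp add: card_PiE)

lemma edge_of_multipartite:
  "{(i, a), (j, b)} \<in> edges (complete_multipartite r n) \<longleftrightarrow>
    i \<in> {1..r} \<and> j \<in> {1..r} \<and> a < n i \<and> b < n j \<and> i \<noteq> j"
  by (auto simp: complete_multipartite_def Let_def doubleton_eq_iff)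

text \<open>
  A clique meets each class at most once, so it is the graph of a function from a set \<open>A\<close> of
  classes to positions within the classes. The condition \<open>s \<ge> 2\<close> makes edges alone decide what an
  \<open>s\<close>-clique is: a single vertex of a multipartite graph might be missing from \<open>H\<close>.
\<close>

lemma card_copies_complete_graph_multipartite:
  assumes H: "subgraph H (complete_multipartite r n)" and s: "s \<ge> 2"
  shows "card (copies (complete_graph s) H) =
    (\<Sum>A\<in>{A. A \<subseteq> {1..r} \<and> card A = s}. card {x \<in> tuples n A. transversal_clique (edges H) A x})"
proof -
  let ?cliques = "{S. S \<subseteq> verts H \<and> card S = s \<and> (\<forall>u\<in>S. \<forall>v\<in>S. u \<noteq> v \<longrightarrow> {u, v} \<in> edges H)}"
  let ?I = "{A. A \<subseteq> {1..r} \<and> card A = s}"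
  let ?C = "\<lambda>A. {x \<in> tuples n A. transversal_clique (edges H) A x}"
  let ?graph = "\<lambda>(A, x). (\<lambda>i. (i, x i)) ` A"
  have simple: "simple_graph H" using H by (simp add: subgraph_def)
  have sub: "edges H \<subseteq> edges (complete_multipartite r n)" using H by (simp add: subgraph_def)
  have finI: "finite ?I" by simp
  have finC: "finite (?C A)" if "A \<in> ?I" for A
  proof -
    have "finite A" using that finite_subset by blast
    then show ?thesis by (simp add: finite_PiE)
  qed
  have inj: "inj_on ?graph (Sigma ?I ?C)"
  proof (rule inj_onI, clarify)
    fix A x B y
    assume x: "x \<in> tuples n A" and y: "y \<in> tuples n B"
      and eq: "(\<lambda>i. (i, x i)) ` A = (\<lambda>i. (i, y i)) ` B"
    have "A = fst ` (\<lambda>i. (i, x i)) ` A" "B = fst ` (\<lambda>i. (i, y i)) ` B" by force+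
    then have AB: "A = B" using eq by simp
    have "x i = y i" if "i \<in> A" for i using eq that by auto
    then show "A = B \<and> x = y"
      using AB x y PiE_ext[of x A _ y] by simp
  qed
  have img: "?graph ` Sigma ?I ?C = ?cliques"
  proof (intro equalityI subsetI)
    fix S assume "S \<in> ?graph ` Sigma ?I ?C"
    then obtain A x where A: "A \<subseteq> {1..r}" "card A = s" and x: "transversal_clique (edges H) A x"
      and S: "S = (\<lambda>i. (i, x i)) ` A" by auto
    have "inj_on (\<lambda>i. (i, x i)) A" by (auto simp: inj_on_def)
    then have "card S = s" using S A card_image by blast
    moreover have adj: "\<forall>u\<in>S. \<forall>v\<in>S. u \<noteq> v \<longrightarrow> {u, v} \<in> edges H"
      using x S by (auto simp: transversal_clique_def)
    \<comment> \<open>As \<open>s \<ge> 2\<close>, every vertex of the tuple lies on an edge, and hence in \<open>H\<close>.\<close>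
    moreover have "S \<subseteq> verts H"
    proof
      fix u assume u: "u \<in> S"
      have "S \<noteq> {u}" using \<open>card S = s\<close> s by auto
      then obtain v where "v \<in> S" "v \<noteq> u" using u by blast
      then have "{u, v} \<in> edges H" using adj[rule_format, of u v] u by simp
      then have "{u, v} \<subseteq> verts H" using simple unfolding simple_graph_def by blast
      then show "u \<in> verts H" by simp
    qed
    ultimately show "S \<in> ?cliques" by blast
  next
    fix S assume S: "S \<in> ?cliques"
    let ?A = "fst ` S"
    have inV: "u \<in> verts (complete_multipartite r n)" if "u \<in> S" for u
      using that S H by (auto simp: subgraph_def)
    have V: "fst u \<in> {1..r}" "snd u < n (fst u)" if "u \<in> S" for u
      using inV[OF that] by (auto simp: complete_multipartite_def Let_def)
    have inj: "inj_on fst S"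
    proof (rule inj_onI)
      fix u v assume uv: "u \<in> S" "v \<in> S" "fst u = fst v"
      show "u = v"
      proof (rule ccontr)
        assume "u \<noteq> v"
        then have "{u, v} \<in> edges (complete_multipartite r n)" using S uv sub by blast
        then have "{(fst u, snd u), (fst v, snd v)} \<in> edges (complete_multipartite r n)" by simp
        then show False using uv(3) unfolding edge_of_multipartite by blast
      qed
    qed
    define x where "x = restrict (\<lambda>i. snd (the_inv_into S fst i)) ?A"
    have x: "(fst u, x (fst u)) = u" if "u \<in> S" for u
      using that by (simp add: x_def the_inv_into_f_f[OF inj])
    have im: "?graph (?A, x) = S"
      using x by (simp add: image_image)
    have "x \<in> tuples n ?A"
    proof (rule PiE_I)
      fix i assume "i \<in> ?A"
      then obtain u where "u \<in> S" "i = fst u" by auto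
      then show "x i \<in> {..<n i}" using V(2)[of u] x[of u] by (metis lessThan_iff snd_conv)
    qed (simp add: x_def)
    moreover have "transversal_clique (edges H) ?A x"
    proof (unfold transversal_clique_def, intro ballI impI)
      fix i j assume "i \<in> ?A" "j \<in> ?A" "i \<noteq> j"
      then obtain u v where "u \<in> S" "i = fst u" "v \<in> S" "j = fst v" "u \<noteq> v" by auto
      then show "{(i, x i), (j, x j)} \<in> edges H" using S x by auto
    qed
    moreover have "?A \<subseteq> {1..r}" "card ?A = s"
      using V(1) S card_image[OF inj] by auto
    ultimately have "(?A, x) \<in> Sigma ?I ?C" by simp
    then show "S \<in> ?graph ` Sigma ?I ?C" by (intro image_eqI[where f = ?graph, OF im[symmetric]])
  qed
  have "card ?cliques = card (Sigma ?I ?C)" using card_image[OF inj] unfolding img .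
  also have "\<dots> = (\<Sum>A\<in>?I. card (?C A))" using finI finC by simp
  finally show ?thesis
    by (subst copies_complete_graph[OF simple], subst card_image) (auto simp: inj_on_def)
qed

text \<open>
  The restriction of a uniform transversal to \<open>A\<close> is uniform: every tuple on \<open>A\<close> has the same
  number of extensions to \<open>I\<close>. This lets cliques on different index sets be counted over one
  common sample space, the tuples on \<open>I\<close>.
\<close>

lemma card_tuples_restricting_to_clique:
  assumes "finite I" and "A \<subseteq> I"
  shows "card {x \<in> tuples n I. transversal_clique E A x} =
    card {y \<in> tuples n A. transversal_clique E A y} * (\<Prod>i\<in>I - A. n i)"
proof -
  let ?X = "{x \<in> tuples n I. transversal_clique E A x}"
  let ?Y = "{y \<in> tuples n A. transversal_clique E A y}"
  have "bij_betw (\<lambda>x. (restrict x A, restrict x (I - A))) ?X (?Y \<times> tuples n (I - A))"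
  proof (rule bij_betw_byWitness[where f' = "\<lambda>(y, z) i. if i \<in> A then y i else z i"])
    show "\<forall>x\<in>?X. (case (restrict x A, restrict x (I - A)) of
        (y, z) \<Rightarrow> \<lambda>i. if i \<in> A then y i else z i) = x"
      using assms by (auto simp: fun_eq_iff restrict_def PiE_def extensional_def)
    show "\<forall>p\<in>?Y \<times> tuples n (I - A). (restrict (case p of (y, z) \<Rightarrow> \<lambda>i. if i \<in> A then y i else z i) A,
        restrict (case p of (y, z) \<Rightarrow> \<lambda>i. if i \<in> A then y i else z i) (I - A)) = p"
      by (auto simp: fun_eq_iff restrict_def PiE_def extensional_def)
    show "(\<lambda>x. (restrict x A, restrict x (I - A))) ` ?X \<subseteq> ?Y \<times> tuples n (I - A)"
      using assms by (auto simp: transversal_clique_def PiE_iff split: if_splits)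
    show "(\<lambda>(y, z) i. if i \<in> A then y i else z i) ` (?Y \<times> tuples n (I - A)) \<subseteq> ?X"
      using assms by (auto simp: transversal_clique_def PiE_iff extensional_def)
  qed
  then have "card ?X = card (?Y \<times> tuples n (I - A))" by (rule bij_betw_same_card)
  then show ?thesis using assms by (simp add: card_cartesian_product card_tuples)
qed

section \<open>The weight of an index pair\<close>

lemma prod_transpose_ge:
  fixes n :: "'i \<Rightarrow> nat"
  assumes "finite A" "a \<in> A" "n a \<le> n b"
  shows "(\<Prod>i\<in>A. n i) \<le> (\<Prod>i\<in>transpose a b ` A. n i)"
proof (cases "b \<in> A")
  case True
  then have "transpose a b ` A = A" using assms by (simp add: transpose_image_eq)
  then show ?thesis by simp
next
  case False
  have "transpose a b ` (A - {a}) = A - {a}"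
    using False by (intro transpose_image_eq) auto
  then have "transpose a b ` A = insert b (A - {a})"
    using assms by (metis image_insert insert_Diff transpose_apply_first)
  then have "(\<Prod>i\<in>transpose a b ` A. n i) = n b * (\<Prod>i\<in>A - {a}. n i)"
    using False assms by simp
  moreover have "(\<Prod>i\<in>A. n i) = n a * (\<Prod>i\<in>A - {a}. n i)"
    using assms by (simp add: prod.remove)
  ultimately show ?thesis using assms by simp
qed

text \<open>
  Swapping the indices \<open>a\<close> and \<open>b\<close> injects the sets through \<open>c\<close> and \<open>a\<close> into the sets through
  \<open>c\<close> and \<open>b\<close>. It either leaves a set unchanged or replaces the factor \<open>n a\<close> by the larger \<open>n b\<close>.
\<close>

lemma weight_through_pair_mono:
  fixes n :: "'i \<Rightarrow> nat"
  assumes "finite I" "a \<in> I" "b \<in> I" "c \<noteq> a" "c \<noteq> b" "n a \<le> n b"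
  shows "(\<Sum>A\<in>{A. A \<subseteq> I \<and> card A = s \<and> {c, a} \<subseteq> A}. \<Prod>i\<in>A. n i)
    \<le> (\<Sum>A\<in>{A. A \<subseteq> I \<and> card A = s \<and> {c, b} \<subseteq> A}. \<Prod>i\<in>A. n i)"
proof -
  let ?t = "transpose a b"
  let ?F = "\<lambda>a. {A. A \<subseteq> I \<and> card A = s \<and> {c, a} \<subseteq> A}"
  have inj: "inj_on ((`) ?t) (?F a)"
    by (rule inj_onI) (simp add: inj_image_eq_iff)
  have fin: "finite (?F b)" using assms by simp
  have im: "(`) ?t ` ?F a \<subseteq> ?F b"
  proof clarify
    fix A assume A: "A \<subseteq> I" "s = card A" "{c, a} \<subseteq> A"
    have "?t ` A \<subseteq> I" using A assms by (auto simp: transpose_def)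
    moreover have "card (?t ` A) = card A" by (simp add: card_image)
    moreover have "?t c \<in> ?t ` A" "?t a \<in> ?t ` A" using A by (auto simp del: transpose_apply_first)
    moreover have "?t c = c" using assms by simp
    ultimately show "?t ` A \<subseteq> I \<and> card (?t ` A) = card A \<and> {c, b} \<subseteq> ?t ` A" by simp
  qed
  have "(\<Sum>A\<in>?F a. \<Prod>i\<in>A. n i) \<le> (\<Sum>A\<in>?F a. \<Prod>i\<in>?t ` A. n i)"
    using assms finite_subset by (intro sum_mono prod_transpose_ge) auto
  also have "\<dots> = (\<Sum>A\<in>(`) ?t ` ?F a. \<Prod>i\<in>A. n i)"
    by (rule sum.reindex[OF inj, symmetric, unfolded comp_def])
  also have "\<dots> \<le> (\<Sum>A\<in>?F b. \<Prod>i\<in>A. n i)"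
    using fin im by (intro sum_mono2) auto
  finally show ?thesis .
qed

text \<open>
  Move the pair \<open>{1, 2}\<close> to \<open>{i, j}\<close> with \<open>i < j\<close> one index at a time. Moving 2 to \<open>j\<close> before
  1 to \<open>i\<close> keeps the two indices distinct throughout.
\<close>

lemma weight_through_pair_least_12:
  fixes n :: "nat \<Rightarrow> nat"
  assumes mono: "mono_on {1..r} n" and "i \<in> {1..r}" "j \<in> {1..r}" "i \<noteq> j"
  shows "(\<Sum>A\<in>{A. A \<subseteq> {1..r} \<and> card A = s \<and> {1, 2} \<subseteq> A}. \<Prod>i\<in>A. n i)
    \<le> (\<Sum>A\<in>{A. A \<subseteq> {1..r} \<and> card A = s \<and> {i, j} \<subseteq> A}. \<Prod>i\<in>A. n i)"
proof -
  let ?W = "\<lambda>i j. \<Sum>A\<in>{A. A \<subseteq> {1..r} \<and> card A = s \<and> {i, j} \<subseteq> A}. \<Prod>i\<in>A. n i"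
  have less: "?W 1 2 \<le> ?W i j" if ij: "i \<in> {1..r}" "j \<in> {1..r}" "i < j" for i j
  proof -
    have "?W 1 2 \<le> ?W 1 j"
      using ij by (intro weight_through_pair_mono mono_onD[OF mono]) auto
    also have "\<dots> = ?W j 1" by (simp add: insert_commute)
    also have "\<dots> \<le> ?W j i"
      using ij by (intro weight_through_pair_mono mono_onD[OF mono]) auto
    also have "\<dots> = ?W i j" by (simp add: insert_commute)
    finally show ?thesis .
  qed
  show ?thesis
  proof (cases "i < j")
    case True
    then show ?thesis using less assms by blast
  next
    case False
    then have "?W 1 2 \<le> ?W j i" using less[of j i] assms by simp
    then show ?thesis by (simp add: insert_commute)
  qed
qed

text \<open>
  Applied to \<open>{1, 2}\<close> and to the index pair of a missing edge, this makes a comparison of the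
  lost weights into a comparison of the remaining ones.
\<close>

lemma weight_split_by_pair:
  assumes "finite I"
  shows "(\<Sum>A\<in>{A. A \<subseteq> I \<and> card A = s}. w A) =
    (\<Sum>A\<in>{A. A \<subseteq> I \<and> card A = s \<and> \<not> B \<subseteq> A}. w A) +
    (\<Sum>A\<in>{A. A \<subseteq> I \<and> card A = s \<and> B \<subseteq> A}. w A :: nat)"
proof -
  have "{A. A \<subseteq> I \<and> card A = s} =
    {A. A \<subseteq> I \<and> card A = s \<and> \<not> B \<subseteq> A} \<union> {A. A \<subseteq> I \<and> card A = s \<and> B \<subseteq> A}" by blast
  then show ?thesis using assms by (simp only:) (rule sum.union_disjoint, auto)
qed

lemma sum_over_sets_containing_12:
  fixes w :: "nat set \<Rightarrow> nat"
  assumes "r \<ge> 2" "s \<ge> 2"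
  shows "(\<Sum>A\<in>{A. A \<subseteq> {1..r} \<and> card A = s \<and> {1, 2} \<subseteq> A}. w A) =
    (\<Sum>B\<in>{B. B \<subseteq> {3..r} \<and> card B = s - 2}. w ({1, 2} \<union> B))"
proof (rule sum.reindex_bij_witness[where i = "\<lambda>B. {1, 2} \<union> B" and j = "\<lambda>A. A - {1, 2}"])
  fix A assume "A \<in> {A. A \<subseteq> {1..r} \<and> card A = s \<and> {1, 2} \<subseteq> A}"
  then have A: "A \<subseteq> {1..r}" "card A = s" "{1, 2} \<subseteq> A" by auto
  have "i \<ge> 3" if "i \<in> A" "i \<noteq> 1" "i \<noteq> 2" for i
    using A(1) that by force
  moreover have "card (A - {1, 2}) = s - 2"
    using A by (subst card_Diff_subset) auto
  ultimately show "A - {1, 2} \<in> {B. B \<subseteq> {3..r} \<and> card B = s - 2}" using A by auto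
  show "{1, 2} \<union> (A - {1, 2}) = A" using A by blast
  then show "w ({1, 2} \<union> (A - {1, 2})) = w A" by simp
next
  fix B assume "B \<in> {B. B \<subseteq> {3..r} \<and> card B = s - 2}"
  then have B: "B \<subseteq> {3..r}" "card B = s - 2" by auto
  have fin: "finite B" using B(1) finite_subset by blast
  have "1 \<notin> B" "2 \<notin> B" using B(1) by force+
  then show "{1, 2} \<union> B - {1, 2} = B" by blast
  have "card ({1, 2} \<union> B) = s"
    using \<open>1 \<notin> B\<close> \<open>2 \<notin> B\<close> fin B(2) assms by simp
  moreover have "B \<subseteq> {1..r}" using B(1) by force
  ultimately show "{1, 2} \<union> B \<in> {A. A \<subseteq> {1..r} \<and> card A = s \<and> {1, 2} \<subseteq> A}"
    using assms by auto
qed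

lemma weight_through_12:
  fixes n :: "nat \<Rightarrow> nat"
  assumes "r \<ge> 2" "s \<ge> 2"
  shows "(\<Sum>A\<in>{A. A \<subseteq> {1..r} \<and> card A = s \<and> {1, 2} \<subseteq> A}. \<Prod>i\<in>A. n i) =
    (\<Sum>B\<in>{B. B \<subseteq> {3..r} \<and> card B = s - 2}. n 1 * n 2 * (\<Prod>i\<in>B. n i))"
  unfolding sum_over_sets_containing_12[OF assms]
proof (intro sum.cong refl)
  fix B assume "B \<in> {B. B \<subseteq> {3..r} \<and> card B = s - 2}"
  then have B: "B \<subseteq> {3..r}" by simp
  have "finite B" using B finite_subset by blast
  moreover have "1 \<notin> B" "2 \<notin> B" using B by force+
  ultimately show "(\<Prod>i\<in>{1, 2} \<union> B. n i) = n 1 * n 2 * (\<Prod>i\<in>B. n i)" by simp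
qed

section \<open>Few transversals are cliques\<close>

text \<open>
  Moving every coordinate by the same amount makes distinct shifts of one transversal disjoint, and
  reducing modulo the size of the class makes each shift a permutation of the transversals.
\<close>

definition shift :: "('i \<Rightarrow> nat) \<Rightarrow> 'i set \<Rightarrow> nat \<Rightarrow> ('i \<Rightarrow> nat) \<Rightarrow> 'i \<Rightarrow> nat" where
  "shift n I a x = (\<lambda>i\<in>I. (x i + a) mod n i)"

lemma add_mod_inj:
  fixes u v a m :: nat
  assumes "u < m" "v < m" "(u + a) mod m = (v + a) mod m"
  shows "u = v"
proof (rule linorder_cases[of u v])
  assume "u < v"
  then have "m dvd v + a - (u + a)" using assms by (metis mod_eq_dvd_iff_nat add_le_mono1 less_imp_le)
  then show ?thesis using \<open>u < v\<close> assms by (auto dest: dvd_imp_le)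
next
  assume "v < u"
  then have "m dvd u + a - (v + a)" using assms by (metis mod_eq_dvd_iff_nat add_le_mono1 less_imp_le)
  then show ?thesis using \<open>v < u\<close> assms by (auto dest: dvd_imp_le)
qed

lemma bij_betw_shift:
  assumes "finite I" "\<forall>i\<in>I. n i \<ge> 1"
  shows "bij_betw (shift n I a) (tuples n I) (tuples n I)"
proof -
  have im: "shift n I a ` tuples n I \<subseteq> tuples n I"
    using assms(2) by (auto simp: shift_def)
  have inj: "inj_on (shift n I a) (tuples n I)"
  proof (rule inj_onI)
    fix x y assume xy: "x \<in> tuples n I" "y \<in> tuples n I" and eq: "shift n I a x = shift n I a y"
    have "x i = y i" if "i \<in> I" for i
    proof -
      have "(x i + a) mod n i = (y i + a) mod n i"
        using fun_cong[OF eq, of i] that by (simp add: shift_def)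
      then show ?thesis using xy that by (intro add_mod_inj[of "x i" "n i" "y i"]) auto
    qed
    then show "x = y" using xy by (intro PiE_ext[of x I _ y]) auto
  qed
  have "finite (tuples n I)" using assms(1) by (simp add: finite_PiE)
  then show ?thesis using endo_inj_surj[OF _ im inj] inj by (simp add: bij_betw_def)
qed

text \<open>
  Two shifts by different amounts below \<open>n 1\<close> differ in every coordinate, since no class is smaller
  than the first. The cliques among these \<open>n 1\<close> shifts are therefore pairwise disjoint copies of
  \<open>K\<^sub>r\<close>, and \<open>k\<close> of them would form the forbidden graph.
\<close>

lemma few_clique_shifts:
  assumes free: "free_of (disjoint_copies k (complete_graph r)) H"
    and H: "subgraph H (complete_multipartite r n)"
    and r: "r \<ge> 2" and mono: "mono_on {1..r} n"
  shows "card {a \<in> {..<n 1}. transversal_clique (edges H) {1..r} (shift n {1..r} a x)} \<le> k - 1"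
    (is "card ?S \<le> _")
proof (rule ccontr)
  assume "\<not> card ?S \<le> k - 1"
  then have "k \<le> card ?S" by simp
  then obtain T where "T \<subseteq> ?S" "card T = k" "finite T"
    by (meson obtain_subset_with_card_n)
  then obtain b where b: "bij_betw b {..<k} T"
    by (metis ex_bij_betw_nat_finite lessThan_atLeast0)
  define y where "y l = shift n {1..r} (b l) x" for l
  \<comment> \<open>The vertices of \<open>K\<^sub>r\<close> are \<open>0, \<dots>, r - 1\<close>, whereas the classes are numbered from 1.\<close>
  define f where "f = (\<lambda>(l, i). (Suc i, y l (Suc i)))"
  have bS: "b l \<in> ?S" if "l < k" for l
    using b \<open>T \<subseteq> ?S\<close> that by (auto simp: bij_betw_def)
  have edge: "{f (l, i), f (l, j)} \<in> edges H" if "l < k" "i < r" "j < r" "i \<noteq> j" for l i j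
    using bS[OF that(1)] that by (auto simp: f_def y_def transversal_clique_def)
  have "inj_on f ({..<k} \<times> {..<r})"
  proof (rule inj_onI, clarify)
    fix l i l' j
    assume l: "l < k" "l' < k" and ij: "i < r" "j < r" and eq: "f (l, i) = f (l', j)"
    then have [simp]: "j = i" and eq: "y l (Suc i) = y l' (Suc i)"
      by (auto simp: f_def)
    have "n 1 \<le> n (Suc i)" using ij by (intro mono_onD[OF mono]) auto
    then have lt: "b l < n (Suc i)" "b l' < n (Suc i)" using bS l by fastforce+
    have "(b l + x (Suc i)) mod n (Suc i) = (b l' + x (Suc i)) mod n (Suc i)"
      using eq ij by (simp add: y_def shift_def add.commute)
    with lt have "b l = b l'" by (rule add_mod_inj)
    then have "l = l'" using b l by (auto simp: bij_betw_def inj_on_def)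
    then show "l = l' \<and> i = j" by simp
  qed
  moreover have "f ` ({..<k} \<times> {..<r}) \<subseteq> verts H"
  proof (rule image_subsetI, clarify)
    fix l i assume li: "l < k" "i < r"
    obtain j where "j < r" "j \<noteq> i" using r that[of "if i = 0 then 1 else 0"] by auto
    then have "{f (l, i), f (l, j)} \<in> edges H" using edge[of l i j] li by simp
    then show "f (l, i) \<in> verts H"
      using H by (auto simp: subgraph_def simple_graph_def)
  qed
  moreover have "\<forall>l<k. \<forall>i<r. \<forall>j<r. i \<noteq> j \<longrightarrow> {f (l, i), f (l, j)} \<in> edges H"
    by (intro allI impI edge)
  ultimately show False
    by - (rule notE[OF free[unfolded free_of_disjoint_complete_graphs]], intro exI[of _ f] conjI)
qed

text \<open>
  Double counting of the pairs \<open>(x, a)\<close> with \<open>a < n 1\<close> such that the shift of \<open>x\<close> by \<open>a\<close> is a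
  clique: for fixed \<open>a\<close>, shifting permutes the transversals, and for fixed \<open>x\<close> there are at most
  \<open>k - 1\<close> such \<open>a\<close>.
\<close>

lemma card_clique_transversals_le:
  assumes free: "free_of (disjoint_copies k (complete_graph r)) H"
    and H: "subgraph H (complete_multipartite r n)"
    and r: "r \<ge> 2" and mono: "mono_on {1..r} n" and pos: "\<forall>i\<in>{1..r}. n i \<ge> 1"
  shows "n 1 * card {x \<in> tuples n {1..r}. transversal_clique (edges H) {1..r} x}
    \<le> (k - 1) * (\<Prod>i\<in>{1..r}. n i)"
proof -
  let ?I = "{1..r}"
  let ?c = "\<lambda>x. if transversal_clique (edges H) ?I x then 1 else (0 :: nat)"
  have fin: "finite (tuples n ?I)" by (simp add: finite_PiE)
  have "n 1 * card {x \<in> tuples n ?I. transversal_clique (edges H) ?I x} =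
      (\<Sum>a<n 1. \<Sum>x\<in>tuples n ?I. ?c x)"
    using fin by (simp flip: sum.inter_filter)
  also have "\<dots> = (\<Sum>a<n 1. \<Sum>x\<in>tuples n ?I. ?c (shift n ?I a x))"
    using bij_betw_shift[OF _ pos]
    by (intro sum.cong refl sum.reindex_bij_betw[symmetric]) auto
  also have "\<dots> = (\<Sum>x\<in>tuples n ?I. \<Sum>a<n 1. ?c (shift n ?I a x))"
    by (rule sum.swap)
  also have "\<dots> = (\<Sum>x\<in>tuples n ?I. card {a \<in> {..<n 1}. transversal_clique (edges H) ?I (shift n ?I a x)})"
    by (simp flip: sum.inter_filter)
  also have "\<dots> \<le> (\<Sum>x\<in>tuples n ?I. k - 1)"
    by (intro sum_mono few_clique_shifts[OF free H r mono])
  also have "\<dots> = (k - 1) * (\<Prod>i\<in>?I. n i)"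
    by (simp add: card_tuples)
  finally show ?thesis .
qed

section \<open>The upper bound\<close>

text \<open>
  A single missing edge costs the weight of all index sets through its two classes, which is at
  least the weight of the sets through \<open>{1, 2}\<close>. Only a transversal that is a clique on all classes
  can exceed the weight of the sets that do not contain \<open>{1, 2}\<close>.
\<close>

lemma weight_of_cliques_in_transversal:
  fixes n :: "nat \<Rightarrow> nat"
  assumes mono: "mono_on {1..r} n"
  shows "(\<Sum>A\<in>{A. A \<subseteq> {1..r} \<and> card A = s}. if transversal_clique E A x then \<Prod>i\<in>A. n i else 0)
    \<le> (\<Sum>A\<in>{A. A \<subseteq> {1..r} \<and> card A = s \<and> \<not> {1, 2} \<subseteq> A}. \<Prod>i\<in>A. n i) +
      (if transversal_clique E {1..r} x
       then \<Sum>A\<in>{A. A \<subseteq> {1..r} \<and> card A = s \<and> {1, 2} \<subseteq> A}. \<Prod>i\<in>A. n i else 0)"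
    (is "?L \<le> ?W' + (if _ then ?W else 0)")
proof (cases "transversal_clique E {1..r} x")
  case True
  have "?L \<le> (\<Sum>A\<in>{A. A \<subseteq> {1..r} \<and> card A = s}. \<Prod>i\<in>A. n i)"
    by (intro sum_mono) simp
  then show ?thesis using True by (simp add: weight_split_by_pair[where B = "{1, 2}"])
next
  case False
  then obtain i j where ij: "i \<in> {1..r}" "j \<in> {1..r}" "i \<noteq> j" "{(i, x i), (j, x j)} \<notin> E"
    by (auto simp: transversal_clique_def)
  let ?V' = "\<Sum>A\<in>{A. A \<subseteq> {1..r} \<and> card A = s \<and> \<not> {i, j} \<subseteq> A}. \<Prod>i\<in>A. n i"
  let ?V = "\<Sum>A\<in>{A. A \<subseteq> {1..r} \<and> card A = s \<and> {i, j} \<subseteq> A}. \<Prod>i\<in>A. n i"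
  have zero: "\<not> transversal_clique E A x" if "{i, j} \<subseteq> A" for A
    using ij that by (auto simp: transversal_clique_def)
  have "?L = (\<Sum>A\<in>{A. A \<subseteq> {1..r} \<and> card A = s \<and> \<not> {i, j} \<subseteq> A}.
      if transversal_clique E A x then \<Prod>i\<in>A. n i else 0)"
    by (rule sum.mono_neutral_right) (use zero in auto)
  also have "\<dots> \<le> ?V'" by (intro sum_mono) simp
  finally have "?L \<le> ?V'" .
  moreover have "?V' + ?V = ?W' + ?W"
    using weight_split_by_pair[of "{1..r}" "\<lambda>A. \<Prod>i\<in>A. n i" s "{1, 2}"]
      weight_split_by_pair[of "{1..r}" "\<lambda>A. \<Prod>i\<in>A. n i" s "{i, j}"] by simp
  moreover have "?W \<le> ?V" by (rule weight_through_pair_least_12[OF mono ij(1-3)])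
  ultimately show ?thesis using False by simp
qed

text \<open>
  The averaging argument, with the probabilities multiplied by the number of transversals
  \<open>\<Prod>i\<in>{1..r}. n i\<close> so that it stays within the natural numbers. That factor is cancelled at the
  end, which needs it to be positive.
\<close>

lemma card_copies_upper_bound:
  assumes free: "free_of (disjoint_copies k (complete_graph r)) H"
    and H: "subgraph H (complete_multipartite r n)"
    and r: "r \<ge> 2" and s: "s \<ge> 2" and mono: "mono_on {1..r} n"
    and pos: "\<forall>i\<in>{1..r}. n i \<ge> 1"
  shows "card (copies (complete_graph s) H) \<le>
    (\<Sum>A\<in>{A. A \<subseteq> {1..r} \<and> card A = s \<and> \<not> {1, 2} \<subseteq> A}. \<Prod>i\<in>A. n i) +
    (\<Sum>A\<in>{A. A \<subseteq> {3..r} \<and> card A = s - 2}. (k - 1) * n 2 * (\<Prod>i\<in>A. n i))"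
    (is "_ \<le> ?W' + ?R")
proof -
  let ?I = "{1..r}"
  let ?J = "{A. A \<subseteq> ?I \<and> card A = s}"
  let ?P = "\<Prod>i\<in>?I. n i"
  let ?Q = "\<lambda>A. transversal_clique (edges H) A"
  let ?W = "\<Sum>A\<in>{A. A \<subseteq> ?I \<and> card A = s \<and> {1, 2} \<subseteq> A}. \<Prod>i\<in>A. n i"
  let ?e = "\<Sum>B\<in>{B. B \<subseteq> {3..r} \<and> card B = s - 2}. \<Prod>i\<in>B. n i"
  have fin: "finite (tuples n ?I)" by (simp add: finite_PiE)
  \<comment> \<open>Each tuple on \<open>A\<close> extends to a transversal in \<open>\<Prod>i\<in>?I - A. n i\<close> ways; the weight of \<open>A\<close>
    supplies the complementary factor of \<open>?P\<close>.\<close>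
  have scale: "?P * card {y \<in> tuples n A. ?Q A y} =
      (\<Sum>x\<in>tuples n ?I. if ?Q A x then \<Prod>i\<in>A. n i else 0)" if "A \<in> ?J" for A
  proof -
    have A: "A \<subseteq> ?I" using that by simp
    have "?P = (\<Prod>i\<in>?I - A. n i) * (\<Prod>i\<in>A. n i)"
      using A by (intro prod.subset_diff) auto
    then have "?P * card {y \<in> tuples n A. ?Q A y} =
        card {x \<in> tuples n ?I. ?Q A x} * (\<Prod>i\<in>A. n i)"
      using A by (simp add: card_tuples_restricting_to_clique mult_ac)
    also have "\<dots> = (\<Sum>x\<in>tuples n ?I. if ?Q A x then \<Prod>i\<in>A. n i else 0)"
      using fin by (simp flip: sum.inter_filter)
    finally show ?thesis .
  qed
  have "?P * card (copies (complete_graph s) H) =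
      (\<Sum>A\<in>?J. \<Sum>x\<in>tuples n ?I. if ?Q A x then \<Prod>i\<in>A. n i else 0)"
    by (simp only: card_copies_complete_graph_multipartite[OF H s] sum_distrib_left)
      (rule sum.cong[OF refl scale])
  also have "\<dots> = (\<Sum>x\<in>tuples n ?I. \<Sum>A\<in>?J. if ?Q A x then \<Prod>i\<in>A. n i else 0)"
    by (rule sum.swap)
  also have "\<dots> \<le> (\<Sum>x\<in>tuples n ?I. ?W' + (if ?Q ?I x then ?W else 0))"
    by (rule sum_mono) (rule weight_of_cliques_in_transversal[OF mono])
  also have "\<dots> = ?P * ?W' + card {x \<in> tuples n ?I. ?Q ?I x} * ?W"
    using fin by (simp add: sum.distrib card_tuples flip: sum.inter_filter)
  also have "?W = n 1 * (n 2 * ?e)"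
    by (simp only: weight_through_12[OF r s] sum_distrib_left mult.assoc)
  also have "card {x \<in> tuples n ?I. ?Q ?I x} * (n 1 * (n 2 * ?e)) =
      (n 1 * card {x \<in> tuples n ?I. ?Q ?I x}) * (n 2 * ?e)" by (simp only: mult_ac)
  also have "\<dots> \<le> ((k - 1) * ?P) * (n 2 * ?e)"
    by (intro mult_right_mono card_clique_transversals_le[OF free H r mono pos]) simp
  also have "\<dots> = ?P * ?R"
    by (simp only: sum_distrib_left mult_ac)
  finally have "?P * card (copies (complete_graph s) H) \<le> ?P * (?W' + ?R)"
    by (simp add: distrib_left)
  moreover have "?P > 0" using pos by (auto simp: Suc_le_eq intro!: prod_pos)
  ultimately show ?thesis by simp
qed

section \<open>The extremal graph\<close>

definition extremal_graph :: "nat \<Rightarrow> (nat \<Rightarrow> nat) \<Rightarrow> nat \<Rightarrow> (nat \<times> nat) graph" where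
  "extremal_graph r n k = Graph (verts (complete_multipartite r n))
    (edges (complete_multipartite r n) - {{(1, a), (2, b)} | a b. k - 1 \<le> a})"

lemma subgraph_extremal_graph: "subgraph (extremal_graph r n k) (complete_multipartite r n)"
  using simple_graph_complete_multipartite[of r n]
  by (auto simp: subgraph_def simple_graph_def extremal_graph_def)

lemma edge_of_extremal_graph:
  "{(i, a), (j, b)} \<in> edges (extremal_graph r n k) \<longleftrightarrow>
    i \<in> {1..r} \<and> j \<in> {1..r} \<and> a < n i \<and> b < n j \<and> i \<noteq> j \<and>
    (i = 1 \<and> j = 2 \<longrightarrow> a < k - 1) \<and> (i = 2 \<and> j = 1 \<longrightarrow> b < k - 1)"
  unfolding extremal_graph_def graph.sel Diff_iff edge_of_multipartite
  by (auto simp: doubleton_eq_iff)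

text \<open>
  The \<open>k\<close> disjoint \<open>r\<close>-cliques would use \<open>k\<close> distinct vertices of class 1 with a neighbour in
  class 2, but there are only \<open>k - 1\<close> of them.
\<close>

lemma extremal_graph_free:
  assumes r: "r \<ge> 2" and k: "k \<ge> 1"
  shows "free_of (disjoint_copies k (complete_graph r)) (extremal_graph r n k)"
proof (unfold free_of_disjoint_complete_graphs, rule notI, elim exE conjE)
  fix f :: "nat \<times> nat \<Rightarrow> nat \<times> nat"
  assume inj: "inj_on f ({..<k} \<times> {..<r})"
    and E: "\<forall>l<k. \<forall>i<r. \<forall>j<r. i \<noteq> j \<longrightarrow>
      {f (l, i), f (l, j)} \<in> edges (extremal_graph r n k)"
  have edge: "fst (f (l, i)) \<in> {1..r} \<and> fst (f (l, i)) \<noteq> fst (f (l, j)) \<and>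
    (fst (f (l, i)) = 1 \<and> fst (f (l, j)) = 2 \<longrightarrow> snd (f (l, i)) < k - 1)"
    if "l < k" "i < r" "j < r" "i \<noteq> j" for l i j
  proof -
    have "{(fst (f (l, i)), snd (f (l, i))), (fst (f (l, j)), snd (f (l, j)))} \<in> edges (extremal_graph r n k)"
      using E[rule_format, OF that] by simp
    then show ?thesis unfolding edge_of_extremal_graph by blast
  qed
  \<comment> \<open>Each of the \<open>k\<close> cliques is a full transversal, so it has a vertex in class 1
    that is adjacent to a vertex in class 2.\<close>
  have ex: "\<exists>i<r. fst (f (l, i)) = 1 \<and> snd (f (l, i)) < k - 1" if l: "l < k" for l
  proof -
    have inj: "inj_on (\<lambda>i. fst (f (l, i))) {..<r}"
      using edge[OF l] by (force intro: inj_onI)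
    have "(\<lambda>i. fst (f (l, i))) ` {..<r} \<subseteq> {1..r}"
    proof
      fix c assume "c \<in> (\<lambda>i. fst (f (l, i))) ` {..<r}"
      then obtain i where i: "i < r" "c = fst (f (l, i))" by auto
      obtain j where "j < r" "i \<noteq> j" using r that[of "if i = 0 then 1 else 0"] by auto
      then show "c \<in> {1..r}" using edge[OF l] i by blast
    qed
    then have "(\<lambda>i. fst (f (l, i))) ` {..<r} = {1..r}"
      by (intro card_subset_eq) (simp_all add: card_image[OF inj])
    moreover have "1 \<in> {1..r}" "2 \<in> {1..r}" using r by auto
    ultimately obtain i j where ij: "i < r" "fst (f (l, i)) = 1" "j < r" "fst (f (l, j)) = 2"
      by (metis (no_types, lifting) imageE lessThan_iff)
    then have "i \<noteq> j" by auto
    then show ?thesis using edge[OF l, of i j] ij by blast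
  qed
  then obtain c where c: "\<And>l. l < k \<Longrightarrow> c l < r \<and> fst (f (l, c l)) = 1 \<and> snd (f (l, c l)) < k - 1"
    by metis
  have "inj_on (\<lambda>l. snd (f (l, c l))) {..<k}"
  proof (rule inj_onI)
    fix l m assume lm: "l \<in> {..<k}" "m \<in> {..<k}" "snd (f (l, c l)) = snd (f (m, c m))"
    then have "f (l, c l) = f (m, c m)" using c by (simp add: prod_eq_iff)
    then show "l = m" using inj_onD[OF inj, of "(l, c l)" "(m, c m)"] c lm by auto
  qed
  moreover have "(\<lambda>l. snd (f (l, c l))) ` {..<k} \<subseteq> {..<k - 1}" using c by auto
  ultimately have "card {..<k} \<le> card {..<k - 1}" by (intro card_inj_on_le) auto
  then show False using k by simp
qed

text \<open>
  On an index set without \<open>{1, 2}\<close> no edge is missing, so all tuples are cliques. On one with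
  \<open>{1, 2}\<close>, the cliques are the tuples whose first coordinate is below \<open>k - 1\<close>.
\<close>

lemma card_copies_extremal_graph:
  assumes r: "r \<ge> 2" and s: "s \<ge> 2" and k: "k \<le> n 1"
  shows "card (copies (complete_graph s) (extremal_graph r n k)) =
    (\<Sum>A\<in>{A. A \<subseteq> {1..r} \<and> card A = s \<and> \<not> {1, 2} \<subseteq> A}. \<Prod>i\<in>A. n i) +
    (\<Sum>A\<in>{A. A \<subseteq> {3..r} \<and> card A = s - 2}. (k - 1) * n 2 * (\<Prod>i\<in>A. n i))"
proof -
  let ?C = "\<lambda>A. {x \<in> tuples n A. transversal_clique (edges (extremal_graph r n k)) A x}"
  have fin: "finite A" if "A \<subseteq> {1..r}" for A using that finite_subset by blast
  have "?C A = tuples n A" if "A \<subseteq> {1..r}" "\<not> {1, 2} \<subseteq> A" for A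
  proof -
    have "transversal_clique (edges (extremal_graph r n k)) A x" if x: "x \<in> tuples n A" for x
      unfolding transversal_clique_def
    proof (intro ballI impI)
      fix i j assume ij: "i \<in> A" "j \<in> A" "i \<noteq> j"
      have "x i < n i" "x j < n j" using x ij by auto
      moreover have "\<not> (i = 1 \<and> j = 2)" "\<not> (i = 2 \<and> j = 1)"
        using ij \<open>\<not> {1, 2} \<subseteq> A\<close> by auto
      ultimately show "{(i, x i), (j, x j)} \<in> edges (extremal_graph r n k)"
        using ij \<open>A \<subseteq> {1..r}\<close> unfolding edge_of_extremal_graph by blast
    qed
    then show ?thesis by blast
  qed
  then have "card (?C A) = (\<Prod>i\<in>A. n i)" if "A \<subseteq> {1..r}" "\<not> {1, 2} \<subseteq> A" for A
    using that by (simp add: card_tuples fin)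
  moreover have "card (?C ({1, 2} \<union> B)) = (k - 1) * n 2 * (\<Prod>i\<in>B. n i)" if "B \<subseteq> {3..r}" for B
  proof -
    let ?A = "{1, 2} \<union> B"
    \<comment> \<open>The class sizes after shrinking class 1 to the vertices adjacent to class 2.\<close>
    let ?m = "n(1 := k - 1)"
    have "finite B" using that finite_subset by blast
    moreover have "1 \<notin> B" "2 \<notin> B" using that by force+
    ultimately have B: "finite B" "1 \<notin> B" "2 \<notin> B" by blast+
    have A: "?A \<subseteq> {1..r}" using that r by force
    have "?C ?A = tuples ?m ?A"
    proof (intro equalityI subsetI)
      fix x assume "x \<in> ?C ?A"
      then have "x \<in> tuples n ?A" "{(1, x 1), (2, x 2)} \<in> edges (extremal_graph r n k)"
        by (auto simp: transversal_clique_def)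
      then show "x \<in> tuples ?m ?A" by (auto simp: edge_of_extremal_graph PiE_iff)
    next
      fix x assume x: "x \<in> tuples ?m ?A"
      then have x1: "x 1 < k - 1" by (auto simp: PiE_iff)
      have "x i < n i" if "i \<in> ?A" for i
        using x that k by (cases "i = 1") (auto simp: PiE_iff)
      then show "x \<in> ?C ?A"
        using x x1 A by (auto simp: transversal_clique_def edge_of_extremal_graph PiE_iff)
    qed
    then have "card (?C ?A) = (\<Prod>i\<in>?A. ?m i)" using B by (simp add: card_tuples)
    also have "\<dots> = (k - 1) * (n 2 * (\<Prod>i\<in>B. ?m i))" using B by simp
    also have "(\<Prod>i\<in>B. ?m i) = (\<Prod>i\<in>B. n i)" using B by (intro prod.cong) auto
    finally show ?thesis by simp
  qed
  ultimately show ?thesis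
    unfolding card_copies_complete_graph_multipartite[OF subgraph_extremal_graph s]
      weight_split_by_pair[OF finite_atLeastAtMost, where B = "{1, 2}"]
      sum_over_sets_containing_12[OF r s]
    by (intro arg_cong2[where f = "(+)"] sum.cong) auto
qed

theorem theorem1p6:
  fixes s r k :: nat and n :: "nat \<Rightarrow> nat"
  assumes "r \<ge> 4" and "2 \<le> s" and "s \<le> r" and "k \<ge> 1"
    and "\<forall>i\<in>{1..r}. n i \<ge> 1"
    and "mono_on {1..r} n"
    and "k \<le> n 1"
    and "n 4 \<ge> r ^ r * (k - 1) * k ^ (2 * r - 2)"
  shows "ex (complete_multipartite r n) (complete_graph s) (disjoint_copies k (complete_graph r)) =
    (\<Sum>A\<in>{A. A \<subseteq> {1..r} \<and> card A = s \<and> \<not> {1, 2} \<subseteq> A}. \<Prod>i\<in>A. n i) +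
    (\<Sum>A\<in>{A. A \<subseteq> {3..r} \<and> card A = s - 2}. (k - 1) * n 2 * (\<Prod>i\<in>A. n i))"
  unfolding ex_def
proof (rule Max_eqI)
  have r: "r \<ge> 2" using assms(1) by simp
  let ?K = "complete_multipartite r n" and ?F = "disjoint_copies k (complete_graph r)"
  let ?c = "\<lambda>H :: (nat \<times> nat) graph. card (copies (complete_graph s) H)"
  let ?v = "(\<Sum>A\<in>{A. A \<subseteq> {1..r} \<and> card A = s \<and> \<not> {1, 2} \<subseteq> A}. \<Prod>i\<in>A. n i) +
    (\<Sum>A\<in>{A. A \<subseteq> {3..r} \<and> card A = s - 2}. (k - 1) * n 2 * (\<Prod>i\<in>A. n i))"
  have "{?c H | H. subgraph H ?K \<and> free_of ?F H} \<subseteq> ?c ` {H. subgraph H ?K}" by blast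
  then show "finite {?c H | H. subgraph H ?K \<and> free_of ?F H}"
    by (rule finite_subset)
      (intro finite_imageI finite_subgraphs simple_graph_complete_multipartite)
  show "y \<le> ?v" if y: "y \<in> {?c H | H. subgraph H ?K \<and> free_of ?F H}" for y
  proof -
    obtain H where "y = ?c H" "subgraph H ?K" "free_of ?F H" using y by blast
    then show ?thesis
      using card_copies_upper_bound[of k r H n s] r assms(2,5,6) by simp
  qed
  have "?v = ?c (extremal_graph r n k)"
    by (rule card_copies_extremal_graph[where n = n, OF r assms(2,7), symmetric])
  then show "?v \<in> {?c H | H. subgraph H ?K \<and> free_of ?F H}"
    using subgraph_extremal_graph[of r n k] extremal_graph_free[OF r assms(4), of n]
    by (intro CollectI exI[of _ "extremal_graph r n k"] conjI)
qed

end
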